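(* Let $n\ge 1$ and let $X=(X_1,\dots,X_n)$ be a jointly Gaussian random vector whose components $X_1,\dots,X_n$ are standard normal random variables (zero mean and unit variance, with arbitrary covariances). Then $$ \bigl(\operatorname{Cov}(X_j^2,X_k^2)\bigr)_{j,k=1}^n\succeq \frac{2}{n}\,E_n . $$
   Context: $\operatorname{Cov}(Y,Z)=\mathbb{E}[YZ]-\mathbb{E}[Y]\,\mathbb{E}[Z]$. A matrix $M\in\mathbb{R}^{n\times n}$ is positive semidefinite if it is symmetric and $c^TMc\ge 0$ for all $c\in\mathbb{R}^n$; $M\succeq N$ means that $M-N$ is positive semidefinite. $E_n\in\mathbb{R}^{n\times n}$ is the matrix with all entries equal to one. *)

theory Defs
  imports "HOL-Probability.Probability"
begin

(* A point mass counts as a normal variable with variance 0. It needs its own disjunct, because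
   it has no density and normal_density m 0 is the zero function. *)
definition normally_distributed :: "'a measure \<Rightarrow> ('a \<Rightarrow> real) \<Rightarrow> bool" where
  "normally_distributed M Y \<longleftrightarrow>
     (\<exists>\<mu> \<sigma>. 0 < \<sigma> \<and> distributed M lborel Y (normal_density \<mu> \<sigma>)) \<or>
     (\<exists>\<mu>. Y \<in> borel_measurable M \<and> (AE \<omega> in M. Y \<omega> = \<mu>))"

(* Every linear combination of the components is normal. The covariance matrix of X may be
   singular, so X need not have a joint density. *)
definition jointly_gaussian :: "'a measure \<Rightarrow> ('a \<Rightarrow> real ^ 'n) \<Rightarrow> bool" where
  "jointly_gaussian M X \<longleftrightarrow>
     X \<in> borel_measurable M \<and> (\<forall>c. normally_distributed M (\<lambda>\<omega>. \<Sum>j\<in>UNIV. c $ j * X \<omega> $ j))"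

definition Cov :: "'a measure \<Rightarrow> ('a \<Rightarrow> real) \<Rightarrow> ('a \<Rightarrow> real) \<Rightarrow> real" where
  "Cov M Y Z = (LINT \<omega>|M. Y \<omega> * Z \<omega>) - (LINT \<omega>|M. Y \<omega>) * (LINT \<omega>|M. Z \<omega>)"

definition pos_semidef :: "real ^ 'n ^ 'n \<Rightarrow> bool" where
  "pos_semidef A \<longleftrightarrow> transpose A = A \<and> (\<forall>c. 0 \<le> c \<bullet> (A *v c))"

definition loewner_ge :: "real ^ 'n ^ 'n \<Rightarrow> real ^ 'n ^ 'n \<Rightarrow> bool"  (infix "\<succeq>" 50) where
  "A \<succeq> B \<longleftrightarrow> pos_semidef (A - B)"

definition all_ones :: "real ^ 'n ^ 'n" where
  "all_ones = (\<chi> j k. 1)"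

end

theory Submission
  imports Defs
begin

text \<open>
  The Gaussian hypothesis enters only through Isserlis' formula for fourth moments, which turns
  the covariance matrix of the squares into twice the entrywise square of the correlation matrix
  \<open>R\<close>. It remains to show that the entrywise square of a positive semidefinite \<open>n \<times> n\<close> matrix with
  unit diagonal dominates \<open>1 / n\<close> times the all-ones matrix.

  For this, write \<open>R\<close> as the Gram matrix of vectors \<open>v\<^sub>j\<close> in an \<open>n\<close>-dimensional space
  (\<open>gram_factorization\<close>), and for given coefficients \<open>c\<^sub>j\<close> consider the symmetric matrix
  \<open>S = \<Sum>j. c\<^sub>j v\<^sub>j v\<^sub>j\<^sup>T\<close>. Its trace is \<open>\<Sum>j. c\<^sub>j\<close>, because the \<open>v\<^sub>j\<close> are unit vectors, and its squared
  Frobenius norm is \<open>\<Sum>j k. c\<^sub>j c\<^sub>k R\<^sub>j\<^sub>k\<^sup>2\<close>, the quadratic form under study. The claim is therefore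
  the inequality \<open>(tr S)\<^sup>2 \<le> n \<parallel>S\<parallel>\<^sup>2\<close>, which is Cauchy--Schwarz on the diagonal
  (\<open>entrywise_square_lower_bound\<close>).

  Isserlis' formula \<open>E[Y\<^sup>2 Z\<^sup>2] = 1 + 2 E[Y Z]\<^sup>2\<close> for unit variances comes from polarization: the
  variables \<open>Y + Z\<close> and \<open>Y - Z\<close> are themselves centred normal, so their fourth moments are
  three times the squares of their variances, and the sum of these fourth moments contains
  \<open>12 E[Y\<^sup>2 Z\<^sup>2]\<close>.
\<close>

section \<open>Entrywise squares of positive semidefinite matrices\<close>

text \<open>
  Induction on the index set, eliminating one index \<open>i\<close> by a Schur complement: the vector
  coordinate labelled \<open>i\<close> absorbs row \<open>i\<close>, and the remainder is again positive semidefinite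
  because its quadratic form is the minimum of the original one over the coefficient at \<open>i\<close>.
  The number of coordinates equals the number of indices, which is what makes the factor \<open>n\<close> in
  the final estimate correct.
\<close>

lemma gram_factorization:
  fixes r :: "'i \<Rightarrow> 'i \<Rightarrow> real"
  assumes "finite I"
    and "\<And>j k. r j k = r k j"
    and "\<And>c. 0 \<le> (\<Sum>j\<in>I. \<Sum>k\<in>I. c j * c k * r j k)"
  shows "\<exists>v. \<forall>j\<in>I. \<forall>k\<in>I. r j k = (\<Sum>m\<in>I. v j m * v k m)"
  using assms
proof (induction I arbitrary: r rule: finite_induct)
  case empty
  show ?case by simp
next
  case (insert i I)
  note sym = insert.prems(1)
  define a where "a = r i i"
  have form: "(\<Sum>j\<in>insert i I. \<Sum>k\<in>insert i I. (c(i := t)) j * (c(i := t)) k * r j k)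
      = (\<Sum>j\<in>I. \<Sum>k\<in>I. c j * c k * r j k) + 2 * t * (\<Sum>k\<in>I. c k * r i k) + t\<^sup>2 * a" for c t
  proof -
    have upd: "(\<Sum>k\<in>I. f k ((c(i := t)) k)) = (\<Sum>k\<in>I. f k (c k))" for f :: "'i \<Rightarrow> real \<Rightarrow> real"
      using insert.hyps by (intro sum.cong) auto
    have "(\<Sum>j\<in>insert i I. \<Sum>k\<in>insert i I. (c(i := t)) j * (c(i := t)) k * r j k)
      = t * t * a + (\<Sum>k\<in>I. t * c k * r i k)
        + (\<Sum>j\<in>I. c j * t * r j i + (\<Sum>k\<in>I. c j * c k * r j k))"
      using insert.hyps upd[of "\<lambda>k y. t * y * r i k"]
        upd[of "\<lambda>j y. y * t * r j i + (\<Sum>k\<in>I. y * c k * r j k)"]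
        upd[of "\<lambda>k y. _ * y * r _ k"]
      by (simp add: a_def)
    also have "(\<Sum>j\<in>I. c j * t * r j i + (\<Sum>k\<in>I. c j * c k * r j k))
        = t * (\<Sum>k\<in>I. c k * r i k) + (\<Sum>j\<in>I. \<Sum>k\<in>I. c j * c k * r j k)"
      by (simp add: sum.distrib sum_distrib_left sym[of _ i] ac_simps)
    finally show ?thesis
      by (simp add: sum_distrib_left power2_eq_square ac_simps)
  qed
  have nonneg: "0 \<le> (\<Sum>j\<in>I. \<Sum>k\<in>I. c j * c k * r j k) + 2 * t * (\<Sum>k\<in>I. c k * r i k) + t\<^sup>2 * a"
    for c t
    using insert.prems(2)[of "c(i := t)"] unfolding form .
  have a0: "0 \<le> a"
    using nonneg[of "\<lambda>_. 0" 1] by simp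
  \<comment> \<open>A vanishing diagonal entry forces its row to vanish: otherwise a large multiple of index \<open>i\<close>
    would make the quadratic form negative.\<close>
  have row0: "r i j = 0" if "a = 0" "j \<in> I" for j
  proof (rule ccontr)
    assume nz: "r i j \<noteq> 0"
    let ?c = "\<lambda>k. if k = j then 1 else 0 :: real"
    have c1: "(\<Sum>k\<in>I. ?c k * f k) = f j" for f
      using insert.hyps that by (simp add: if_distrib[where f = "\<lambda>x. x * _"] cong: if_cong)
    have "(\<Sum>j\<in>I. \<Sum>k\<in>I. ?c j * ?c k * r j k) = r j j"
      using c1 by (simp only: mult.assoc flip: sum_distrib_left)
    then have "0 \<le> r j j + 2 * t * r i j" for t
      using nonneg[of ?c t] c1[of "r i"] that by simp
    from this[of "- (r j j + 1) / (2 * r i j)"] nz show False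
      by (simp add: field_simps)
  qed
  define s where "s j k = r j k - r i j * r i k / a" for j k
  have s_nonneg: "0 \<le> (\<Sum>j\<in>I. \<Sum>k\<in>I. c j * c k * s j k)" for c
  proof -
    let ?b = "\<Sum>k\<in>I. c k * r i k"
    have "(\<Sum>j\<in>I. \<Sum>k\<in>I. c j * c k * s j k)
        = (\<Sum>j\<in>I. \<Sum>k\<in>I. c j * c k * r j k) - ?b * ?b / a"
      by (simp add: s_def right_diff_distrib sum_subtractf sum_product sum_divide_distrib ac_simps)
    \<comment> \<open>The coefficient \<open>- ?b / a\<close> at \<open>i\<close> minimizes the quadratic form. If \<open>a = 0\<close>, it is \<open>0\<close> because
      division by zero yields zero, and \<open>s\<close> is \<open>r\<close>.\<close>
    also have "\<dots> = (\<Sum>j\<in>I. \<Sum>k\<in>I. c j * c k * r j k) + 2 * (- ?b / a) * ?b + (- ?b / a)\<^sup>2 * a"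
      by (cases "a = 0") (simp_all add: power2_eq_square)
    finally show ?thesis
      using nonneg[of c "- ?b / a"] by simp
  qed
  obtain w where w: "\<And>j k. j \<in> I \<Longrightarrow> k \<in> I \<Longrightarrow> s j k = (\<Sum>m\<in>I. w j m * w k m)"
    using insert.IH[of s] s_nonneg sym by (auto simp: s_def mult.commute)
  define v where
    "v j m = (if m = i then r i j / sqrt a else if j = i then 0 else w j m)" for j m
  have split: "(\<Sum>m\<in>insert i I. v j m * v k m)
      = r i j * r i k / a + (\<Sum>m\<in>I. if j = i \<or> k = i then 0 else w j m * w k m)" for j k
  proof -
    have "(\<Sum>m\<in>I. v j m * v k m) = (\<Sum>m\<in>I. if j = i \<or> k = i then 0 else w j m * w k m)"
      using insert.hyps by (intro sum.cong) (auto simp: v_def)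
    then show ?thesis
      using insert.hyps a0 by (simp add: v_def)
  qed
  have "r j k = (\<Sum>m\<in>insert i I. v j m * v k m)" if "j \<in> insert i I" "k \<in> insert i I" for j k
  proof (cases "j = i \<or> k = i")
    case True
    then show ?thesis
      unfolding split using that row0 sym[of j i] by (cases "a = 0") (auto simp: a_def)
  next
    case False
    with that have "j \<in> I" "k \<in> I" by auto
    from w[OF this] False show ?thesis
      unfolding split by (simp add: s_def)
  qed
  then show ?case by blast
qed

text \<open>
  The numbers \<open>S p q\<close> below are the entries of \<open>\<Sum>j. c j v\<^sub>j v\<^sub>j\<^sup>T\<close> for the Gram vectors \<open>v\<^sub>j\<close> of \<open>r\<close>;
  the left-hand side is the square of its trace, and the sum on the right is its squared
  Frobenius norm.
\<close>

lemma entrywise_square_lower_bound: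
  fixes r :: "'i \<Rightarrow> 'i \<Rightarrow> real"
  assumes "finite I"
    and "\<And>j k. r j k = r k j"
    and "\<And>c. 0 \<le> (\<Sum>j\<in>I. \<Sum>k\<in>I. c j * c k * r j k)"
  shows "(\<Sum>j\<in>I. c j * r j j)\<^sup>2 \<le> real (card I) * (\<Sum>j\<in>I. \<Sum>k\<in>I. c j * c k * (r j k)\<^sup>2)"
proof -
  obtain v where v: "\<And>j k. j \<in> I \<Longrightarrow> k \<in> I \<Longrightarrow> r j k = (\<Sum>m\<in>I. v j m * v k m)"
    using gram_factorization[OF assms] by blast
  define S where "S p q = (\<Sum>j\<in>I. c j * v j p * v j q)" for p q
  have trace: "(\<Sum>j\<in>I. c j * r j j) = (\<Sum>p\<in>I. S p p)"
  proof -
    have "(\<Sum>j\<in>I. c j * r j j) = (\<Sum>j\<in>I. \<Sum>p\<in>I. c j * v j p * v j p)"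
      by (intro sum.cong) (simp_all add: v sum_distrib_left mult.assoc)
    also have "\<dots> = (\<Sum>p\<in>I. S p p)"
      unfolding S_def by (rule sum.swap)
    finally show ?thesis .
  qed
  have "(\<Sum>p\<in>I. \<Sum>q\<in>I. (S p q)\<^sup>2)
      = (\<Sum>p\<in>I. \<Sum>q\<in>I. \<Sum>j\<in>I. \<Sum>k\<in>I. (c j * v j p * v j q) * (c k * v k p * v k q))"
    by (simp add: S_def power2_eq_square sum_product)
  also have "\<dots> = (\<Sum>p\<in>I. \<Sum>j\<in>I. \<Sum>q\<in>I. \<Sum>k\<in>I. (c j * v j p * v j q) * (c k * v k p * v k q))"
    by (intro sum.cong refl sum.swap)
  also have "\<dots> = (\<Sum>j\<in>I. \<Sum>p\<in>I. \<Sum>q\<in>I. \<Sum>k\<in>I. (c j * v j p * v j q) * (c k * v k p * v k q))"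
    by (rule sum.swap)
  also have "\<dots> = (\<Sum>j\<in>I. \<Sum>p\<in>I. \<Sum>k\<in>I. \<Sum>q\<in>I. (c j * v j p * v j q) * (c k * v k p * v k q))"
    by (intro sum.cong refl sum.swap)
  also have "\<dots> = (\<Sum>j\<in>I. \<Sum>k\<in>I. \<Sum>p\<in>I. \<Sum>q\<in>I. (c j * v j p * v j q) * (c k * v k p * v k q))"
    by (intro sum.cong refl sum.swap)
  also have "\<dots> = (\<Sum>j\<in>I. \<Sum>k\<in>I. c j * c k * (r j k)\<^sup>2)"
    by (intro sum.cong refl)
      (simp add: v power2_eq_square sum_product sum_distrib_left ac_simps)
  finally have frobenius: "(\<Sum>p\<in>I. \<Sum>q\<in>I. (S p q)\<^sup>2) = (\<Sum>j\<in>I. \<Sum>k\<in>I. c j * c k * (r j k)\<^sup>2)" .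
  have "(\<Sum>p\<in>I. S p p)\<^sup>2 \<le> (\<Sum>p\<in>I. (S p p)\<^sup>2) * (\<Sum>p\<in>I. 1\<^sup>2)"
    using Cauchy_Schwarz_ineq_sum[of "\<lambda>p. S p p" "\<lambda>_. 1" I] by simp
  also have "\<dots> = real (card I) * (\<Sum>p\<in>I. (S p p)\<^sup>2)"
    by simp
  also have "\<dots> \<le> real (card I) * (\<Sum>p\<in>I. \<Sum>q\<in>I. (S p q)\<^sup>2)"
    using assms(1) by (intro mult_left_mono sum_mono member_le_sum) auto
  finally show ?thesis
    unfolding trace frobenius .
qed

section \<open>Fourth moments of jointly normal variables\<close>

text \<open>
  The point mass at zero satisfies the fourth-moment identity too. That case is needed below:
  when \<open>Y\<close> and \<open>Z\<close> agree up to sign, one of \<open>Y + Z\<close> and \<open>Y - Z\<close> vanishes.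
\<close>

lemma centred_normal_moments:
  assumes "prob_space M" and "normally_distributed M Y" and mean: "(LINT \<omega>|M. Y \<omega>) = 0"
  shows "integrable M (\<lambda>\<omega>. (Y \<omega>)\<^sup>2)" and "integrable M (\<lambda>\<omega>. (Y \<omega>) ^ 4)"
    and "(LINT \<omega>|M. (Y \<omega>) ^ 4) = 3 * (LINT \<omega>|M. (Y \<omega>)\<^sup>2)\<^sup>2"
proof -
  interpret prob_space M by fact
  have "integrable M (\<lambda>\<omega>. (Y \<omega>)\<^sup>2) \<and> integrable M (\<lambda>\<omega>. (Y \<omega>) ^ 4)
      \<and> (LINT \<omega>|M. (Y \<omega>) ^ 4) = 3 * (LINT \<omega>|M. (Y \<omega>)\<^sup>2)\<^sup>2"
    using assms(2) unfolding normally_distributed_def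
  proof (elim disjE exE conjE)
    fix \<mu> \<sigma> :: real
    assume \<sigma>: "0 < \<sigma>" and D: "distributed M lborel Y (normal_density \<mu> \<sigma>)"
    have "\<mu> = 0"
      using normal_distributed_expectation[OF \<sigma> D] mean by simp
    note D = D[unfolded this]
    have moment: "has_bochner_integral M (\<lambda>\<omega>. (Y \<omega>) ^ (2 * k))
        (fact (2 * k) / ((2 / \<sigma>\<^sup>2) ^ k * fact k))" for k
      using normal_moment_even[OF \<sigma>, of 0 k] distributed_integrable[OF D, of "\<lambda>x. x ^ (2 * k)"]
        distributed_integral[OF D, of "\<lambda>x. x ^ (2 * k)"]
      by (simp add: has_bochner_integral_iff)
    have "has_bochner_integral M (\<lambda>\<omega>. (Y \<omega>)\<^sup>2) (\<sigma>\<^sup>2)"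
      using moment[of 1] by simp
    moreover have "has_bochner_integral M (\<lambda>\<omega>. (Y \<omega>) ^ 4) (3 * (\<sigma>\<^sup>2)\<^sup>2)"
      using moment[of 2] by (simp add: fact_numeral power_divide)
    ultimately show ?thesis
      by (simp add: has_bochner_integral_iff)
  next
    fix \<mu> :: real
    assume meas: "Y \<in> borel_measurable M" and const: "AE \<omega> in M. Y \<omega> = \<mu>"
    have "(LINT \<omega>|M. Y \<omega>) = (LINT \<omega>|M. \<mu>)"
      using meas const by (intro integral_cong_AE) auto
    then have "\<mu> = 0"
      using mean by (simp add: prob_space)
    have power: "has_bochner_integral M (\<lambda>\<omega>. (Y \<omega>) ^ k) 0" if "0 < k" for k
    proof -
      have "AE \<omega> in M. (Y \<omega>) ^ k = 0"
        using const \<open>\<mu> = 0\<close> that by auto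
      then show ?thesis
        using meas has_bochner_integral_cong_AE[of "\<lambda>\<omega>. (Y \<omega>) ^ k" M "\<lambda>_. 0" 0]
        by (simp add: has_bochner_integral_zero)
    qed
    show ?thesis
      using power[of 2] power[of 4] by (simp add: has_bochner_integral_iff)
  qed
  then show "integrable M (\<lambda>\<omega>. (Y \<omega>)\<^sup>2)" "integrable M (\<lambda>\<omega>. (Y \<omega>) ^ 4)"
    "(LINT \<omega>|M. (Y \<omega>) ^ 4) = 3 * (LINT \<omega>|M. (Y \<omega>)\<^sup>2)\<^sup>2"
    by auto
qed

text \<open>
  Writing \<open>Y\<^sup>2 Z\<^sup>2\<close> and \<open>Y Z\<close> as linear combinations of powers of \<open>Y\<close>, \<open>Z\<close>, \<open>Y + Z\<close> and \<open>Y - Z\<close>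
  yields integrability and the value of the integrals at once.
\<close>

lemma Cov_squares_normal:
  assumes M: "prob_space M"
    and Y: "distributed M lborel Y std_normal_density"
    and Z: "distributed M lborel Z std_normal_density"
    and plus: "normally_distributed M (\<lambda>\<omega>. Y \<omega> + Z \<omega>)"
    and minus: "normally_distributed M (\<lambda>\<omega>. Y \<omega> - Z \<omega>)"
  shows "integrable M (\<lambda>\<omega>. Y \<omega> * Z \<omega>)"
    and "Cov M (\<lambda>\<omega>. (Y \<omega>)\<^sup>2) (\<lambda>\<omega>. (Z \<omega>)\<^sup>2) = 2 * (LINT \<omega>|M. Y \<omega> * Z \<omega>)\<^sup>2"
proof -
  interpret prob_space M by fact
  have std: "integrable M V \<and> (LINT \<omega>|M. V \<omega>) = 0
      \<and> integrable M (\<lambda>\<omega>. (V \<omega>)\<^sup>2) \<and> integrable M (\<lambda>\<omega>. (V \<omega>) ^ 4)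
      \<and> (LINT \<omega>|M. (V \<omega>)\<^sup>2) = 1 \<and> (LINT \<omega>|M. (V \<omega>) ^ 4) = 3"
    if V: "distributed M lborel V std_normal_density" for V
  proof -
    have mean: "(LINT \<omega>|M. V \<omega>) = 0"
      using standard_normal_distributed_expectation[OF V] .
    have "normally_distributed M V"
      unfolding normally_distributed_def using V zero_less_one by blast
    note moments = centred_normal_moments[OF M this mean]
    have "(LINT \<omega>|M. (V \<omega>)\<^sup>2) = 1"
      using standard_normal_distributed_variance[OF V] mean by simp
    moreover have "integrable M V"
      using integrable_std_normal_moment[of 1] distributed_integrable[OF V, of "\<lambda>x. x"] by simp
    ultimately show ?thesis
      using moments mean by simp
  qed
  note Ym = std[OF Y] and Zm = std[OF Z]
  have mean_plus: "(LINT \<omega>|M. Y \<omega> + Z \<omega>) = 0" and mean_minus: "(LINT \<omega>|M. Y \<omega> - Z \<omega>) = 0"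
    using Ym Zm by simp_all
  note P = centred_normal_moments[OF M plus mean_plus]
    and N = centred_normal_moments[OF M minus mean_minus]
  define r where "r = (LINT \<omega>|M. Y \<omega> * Z \<omega>)"
  have YZ: "Y \<omega> * Z \<omega> = ((Y \<omega> + Z \<omega>)\<^sup>2 - (Y \<omega> - Z \<omega>)\<^sup>2) / 4" for \<omega>
    by (simp add: power2_eq_square algebra_simps)
  show int: "integrable M (\<lambda>\<omega>. Y \<omega> * Z \<omega>)"
    unfolding YZ using P N by simp
  have "(LINT \<omega>|M. (Y \<omega> + Z \<omega>)\<^sup>2) = (LINT \<omega>|M. (Y \<omega>)\<^sup>2 + (Z \<omega>)\<^sup>2 + 2 * (Y \<omega> * Z \<omega>))"
    by (simp add: power2_sum mult.assoc)
  also have "\<dots> = 2 + 2 * r"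
    using Ym Zm int by (simp add: r_def)
  finally have P2: "(LINT \<omega>|M. (Y \<omega> + Z \<omega>)\<^sup>2) = 2 + 2 * r" .
  have "(LINT \<omega>|M. (Y \<omega> - Z \<omega>)\<^sup>2) = (LINT \<omega>|M. (Y \<omega>)\<^sup>2 + (Z \<omega>)\<^sup>2 - 2 * (Y \<omega> * Z \<omega>))"
    by (simp add: power2_diff mult.assoc)
  also have "\<dots> = 2 - 2 * r"
    using Ym Zm int by (simp add: r_def)
  finally have N2: "(LINT \<omega>|M. (Y \<omega> - Z \<omega>)\<^sup>2) = 2 - 2 * r" .
  have Y2Z2: "(Y \<omega>)\<^sup>2 * (Z \<omega>)\<^sup>2
      = ((Y \<omega> + Z \<omega>) ^ 4 + (Y \<omega> - Z \<omega>) ^ 4 - 2 * (Y \<omega>) ^ 4 - 2 * (Z \<omega>) ^ 4) / 12" for \<omega>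
    by (simp add: power2_eq_square power4_eq_xxxx algebra_simps)
  have "(LINT \<omega>|M. (Y \<omega>)\<^sup>2 * (Z \<omega>)\<^sup>2)
      = (3 * (2 + 2 * r)\<^sup>2 + 3 * (2 - 2 * r)\<^sup>2 - 2 * 3 - 2 * 3) / 12"
    unfolding Y2Z2 using P N Ym Zm by (simp add: P2 N2)
  also have "\<dots> = 1 + 2 * r\<^sup>2"
    by (simp add: power2_eq_square field_simps)
  finally show "Cov M (\<lambda>\<omega>. (Y \<omega>)\<^sup>2) (\<lambda>\<omega>. (Z \<omega>)\<^sup>2) = 2 * (LINT \<omega>|M. Y \<omega> * Z \<omega>)\<^sup>2"
    using Ym Zm by (simp add: Cov_def r_def)
qed

section \<open>The covariance matrix of the squares\<close>

theorem theorem8: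
  fixes M :: "'a measure" and X :: "'a \<Rightarrow> real ^ 'n"
  assumes "prob_space M"
    and "jointly_gaussian M X"
    and "\<And>j. distributed M lborel (\<lambda>\<omega>. X \<omega> $ j) std_normal_density"
  shows "(\<chi> j k. Cov M (\<lambda>\<omega>. (X \<omega> $ j)\<^sup>2) (\<lambda>\<omega>. (X \<omega> $ k)\<^sup>2))
           \<succeq> (2 / real CARD('n)) *\<^sub>R all_ones"
proof -
  interpret prob_space M by fact
  define r where "r j k = (LINT \<omega>|M. X \<omega> $ j * X \<omega> $ k)" for j k
  have normal: "normally_distributed M (\<lambda>\<omega>. X \<omega> $ j + s * X \<omega> $ k)" for j k s
  proof -
    have "(\<Sum>i\<in>UNIV. (axis j 1 + s *\<^sub>R axis k 1) $ i * X \<omega> $ i) = X \<omega> $ j + s * X \<omega> $ k" for \<omega>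
      by (simp add: axis_def distrib_right sum.distrib if_distrib[where f = "\<lambda>x. x * _"]
          if_distrib[where f = "\<lambda>x. _ * x"] cong: if_cong)
    moreover have "normally_distributed M
        (\<lambda>\<omega>. \<Sum>i\<in>UNIV. (axis j 1 + s *\<^sub>R axis k 1 :: real ^ 'n) $ i * X \<omega> $ i)"
      using assms(2) unfolding jointly_gaussian_def by blast
    ultimately show ?thesis by simp
  qed
  note squares = Cov_squares_normal[OF assms(1) assms(3) assms(3)]
  have int: "integrable M (\<lambda>\<omega>. X \<omega> $ j * X \<omega> $ k)"
    and Cov: "Cov M (\<lambda>\<omega>. (X \<omega> $ j)\<^sup>2) (\<lambda>\<omega>. (X \<omega> $ k)\<^sup>2) = 2 * (r j k)\<^sup>2" for j k
    using squares[of j k] normal[of j 1 k] normal[of j "-1" k] by (simp_all add: r_def)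
  have r_sym: "r j k = r k j" for j k
    by (simp add: r_def mult.commute)
  have r_diag: "r j j = 1" for j
    using standard_normal_distributed_variance[OF assms(3)[of j]]
      standard_normal_distributed_expectation[OF assms(3)[of j]]
    by (simp add: r_def power2_eq_square)
  have r_nonneg: "0 \<le> (\<Sum>j\<in>UNIV. \<Sum>k\<in>UNIV. c j * c k * r j k)" for c
  proof -
    have "(\<Sum>j\<in>UNIV. \<Sum>k\<in>UNIV. c j * c k * r j k)
        = (LINT \<omega>|M. (\<Sum>j\<in>UNIV. \<Sum>k\<in>UNIV. c j * c k * (X \<omega> $ j * X \<omega> $ k)))"
      using int by (simp add: r_def)
    also have "\<dots> = (LINT \<omega>|M. (\<Sum>j\<in>UNIV. c j * X \<omega> $ j)\<^sup>2)"
      by (simp add: power2_eq_square sum_product ac_simps)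
    finally show ?thesis by simp
  qed
  let ?A = "(\<chi> j k. Cov M (\<lambda>\<omega>. (X \<omega> $ j)\<^sup>2) (\<lambda>\<omega>. (X \<omega> $ k)\<^sup>2)) - (2 / real CARD('n)) *\<^sub>R all_ones
    :: real ^ 'n ^ 'n"
  have A: "?A $ j $ k = 2 * (r j k)\<^sup>2 - 2 / real CARD('n)" for j k
    by (simp add: Cov all_ones_def)
  have "0 \<le> c \<bullet> (?A *v c)" for c
  proof -
    have "c \<bullet> (?A *v c)
        = (\<Sum>j\<in>UNIV. \<Sum>k\<in>UNIV. c $ j * c $ k * (2 * (r j k)\<^sup>2 - 2 / real CARD('n)))"
      by (simp only: inner_vec_def matrix_vector_mult_def A vec_lambda_beta inner_real_def
          sum_distrib_left ac_simps)
    also have "\<dots> = 2 * (\<Sum>j\<in>UNIV. \<Sum>k\<in>UNIV. c $ j * c $ k * (r j k)\<^sup>2)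
        - 2 * (\<Sum>j\<in>UNIV. c $ j)\<^sup>2 / real CARD('n)"
      by (simp add: right_diff_distrib sum_subtractf power2_eq_square[of "sum _ _"] sum_product
          sum_distrib_left sum_divide_distrib ac_simps)
    finally have form: "c \<bullet> (?A *v c) = \<dots>" .
    have "(\<Sum>j\<in>UNIV. c $ j)\<^sup>2 / real CARD('n) \<le> (\<Sum>j\<in>UNIV. \<Sum>k\<in>UNIV. c $ j * c $ k * (r j k)\<^sup>2)"
      using entrywise_square_lower_bound[OF finite r_sym r_nonneg, of "($) c"]
      by (simp add: r_diag pos_divide_le_eq mult.commute)
    then show ?thesis
      unfolding form by simp
  qed
  moreover have "transpose ?A = ?A"
    by (simp add: vec_eq_iff transpose_def Cov r_sym all_ones_def)
  ultimately show ?thesis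
    unfolding loewner_ge_def pos_semidef_def by blast
qed

end
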